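(* For all $n\in\mathbb N=\{1,2,\dots\}$ and all $k,l\in\mathbb Z$, $$a_n(k\,l)=a_n\bigl(a_n(k)\,a_n(l)\bigr),$$ that is, $k\,l\equiv a_n(k)\,a_n(l)\ (\text{Modd } n)$.
   Context: For $n\in\mathbb N$ and $k\in\mathbb Z$ let $r_n(k)\in\{0,1,\dots,n-1\}$ be the remainder of $k$ on division by $n$, and let $p_n(k)=(-1)^{\lfloor k/n\rfloor}$. Define $a_n:\mathbb Z\to\{0,1,\dots,n-1\}$ by $a_n(k)=r_n(k)$ if $p_n(k)=+1$ and $a_n(k)=r_n(-k)$ if $p_n(k)=-1$. The equivalence relation Modd $n$ on $\mathbb Z$ is defined by: $k\equiv l\ (\text{Modd } n)$ if and only if $a_n(k)=a_n(l)$. *)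

theory Defs
  imports Complex_Main
begin

definition rem :: "nat \<Rightarrow> int \<Rightarrow> int" where
  "rem n k = k mod int n"

text \<open>The exponent is an integer that may be negative, so the sign is an integer power
  (\<open>powi\<close>), which needs a field; hence the real-valued result.\<close>

definition par :: "nat \<Rightarrow> int \<Rightarrow> real" where
  "par n k = (-1) powi \<lfloor>real_of_int k / real n\<rfloor>"

text \<open>The values lie in \<open>{0..<int n}\<close> for positive \<open>n\<close>; they are kept as integers so that
  they can be multiplied and fed back as arguments.\<close>

definition modd_res :: "nat \<Rightarrow> int \<Rightarrow> int" where
  "modd_res n k = (if par n k = 1 then rem n k else rem n (- k))"

definition Modd_eq :: "nat \<Rightarrow> int \<Rightarrow> int \<Rightarrow> bool" where
  "Modd_eq n k l \<longleftrightarrow> modd_res n k = modd_res n l"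

end

theory Submission imports Defs begin

text \<open>
  The residue \<open>a\<^sub>n\<close> is an even function of period \<open>2 n\<close> which vanishes on the multiples of
  \<open>n\<close>, and \<open>a\<^sub>n(k)\<close> is congruent to \<open>k\<close> or \<open>- k\<close> modulo \<open>2 n\<close> for every other \<open>k\<close>.
  Hence \<open>a\<^sub>n(k) a\<^sub>n(l)\<close> is congruent to \<open>k l\<close> or \<open>- k l\<close> modulo \<open>2 n\<close>, unless \<open>n\<close> divides
  \<open>k\<close> or \<open>l\<close>, when both sides are zero.
\<close>

text \<open>A power of -1 is 1 exactly at even exponents, so the sign becomes a parity test on the
  integer quotient.\<close>

lemma modd_res_eq:
  "modd_res n k = (if even (k div int n) then k mod int n else (- k) mod int n)"
proof -
  have "\<lfloor>real_of_int k / real n\<rfloor> = k div int n"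
    by (metis floor_divide_of_int_eq of_int_of_nat_eq)
  then show ?thesis
    by (simp add: modd_res_def par_def rem_def power_int_minus_left)
qed

lemma modd_res_eq_0:
  assumes "int n dvd k"
  shows "modd_res n k = 0"
  using assms by (simp add: modd_res_eq)

text \<open>Off the multiples of \<open>n\<close>, rounding down sends the quotient \<open>q\<close>
  to \<open>- q - 1\<close>, of opposite parity.\<close>

lemma even_minus_div_iff:
  assumes "n \<ge> 1" and "\<not> int n dvd k"
  shows "even ((- k) div int n) \<longleftrightarrow> odd (k div int n)"
proof -
  have "(- k) div int n = - (k div int n) - 1"
    using assms by (simp add: zdiv_zminus1_eq_if dvd_eq_mod_eq_0)
  then show ?thesis by (simp only: even_diff even_minus even_add odd_one) simp
qed

lemma modd_res_minus:
  assumes "n \<ge> 1"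
  shows "modd_res n (- k) = modd_res n k"
proof (cases "int n dvd k")
  case True
  then show ?thesis by (simp add: modd_res_eq_0)
next
  case False
  with assms show ?thesis by (simp add: modd_res_eq even_minus_div_iff)
qed

lemma modd_res_add_mult:
  assumes "n \<ge> 1"
  shows "modd_res n (k + 2 * int n * m) = modd_res n k"
proof -
  \<comment> \<open>Grouped like this, the quotient shifts by the even number
    \<open>2 * m\<close>.\<close>
  have "k + 2 * int n * m = k + int n * (2 * m)" by simp
  moreover have "- (k + int n * (2 * m)) = - k + int n * (- 2 * m)" by simp
  ultimately show ?thesis
    using assms by (simp only: modd_res_eq div_mult_self2 mod_mult_self2) simp
qed

lemma modd_res_cong:
  assumes "n \<ge> 1" and "2 * int n dvd k - l"
  shows "modd_res n k = modd_res n l"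
proof -
  from assms(2) obtain m where "k - l = 2 * int n * m" ..
  then have "k = l + 2 * int n * m" by simp
  then show ?thesis using modd_res_add_mult[OF assms(1)] by simp
qed

lemma mod_eq_of_even_div:
  assumes "even (k div int n)"
  shows "2 * int n dvd k mod int n - k"
proof -
  from assms obtain q where "k div int n = 2 * q" ..
  then have "k mod int n - k = 2 * int n * (- q)"
    using div_mult_mod_eq[of k "int n"] by (simp add: algebra_simps)
  then show ?thesis by (rule dvdI)
qed

text \<open>An odd quotient becomes even on passing to \<open>- k\<close>. An odd multiple of
  \<open>n\<close> has residue 0, congruent to neither \<open>k\<close> nor \<open>- k\<close>
  modulo \<open>2 * int n\<close>.\<close>

lemma modd_res_cases:
  assumes "n \<ge> 1" and "\<not> int n dvd k"
  obtains s :: int where "s = 1 \<or> s = - 1" and "2 * int n dvd modd_res n k - s * k"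
proof (cases "even (k div int n)")
  case True
  then show ?thesis
    using that[of 1] mod_eq_of_even_div by (simp add: modd_res_eq)
next
  case False
  with assms have "even ((- k) div int n)"
    by (simp add: even_minus_div_iff)
  then show ?thesis
    using that[of "- 1"] False mod_eq_of_even_div[of "- k" n] by (simp add: modd_res_eq)
qed

theorem proposition10:
  fixes n :: nat and k l :: int
  assumes "n \<ge> 1"
  shows "modd_res n (k * l) = modd_res n (modd_res n k * modd_res n l)
    \<and> Modd_eq n (k * l) (modd_res n k * modd_res n l)"
proof -
  have "modd_res n (k * l) = modd_res n (modd_res n k * modd_res n l)"
  proof (cases "int n dvd k \<or> int n dvd l")
    case True
    then show ?thesis by (auto simp: modd_res_eq_0)
  next
    case False
    obtain s where s: "s = 1 \<or> s = - 1" "2 * int n dvd modd_res n k - s * k"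
      using False assms by (meson modd_res_cases)
    obtain t where t: "t = 1 \<or> t = - 1" "2 * int n dvd modd_res n l - t * l"
      using False assms by (meson modd_res_cases)
    \<comment> \<open>Replacing one factor at a time leaves a known multiple of
      \<open>2 * int n\<close> in each summand.\<close>
    have "modd_res n k * modd_res n l - (s * t) * (k * l)
        = (modd_res n k - s * k) * modd_res n l + s * k * (modd_res n l - t * l)"
      by (simp add: algebra_simps)
    then have "2 * int n dvd modd_res n k * modd_res n l - (s * t) * (k * l)"
      using s(2) t(2) by simp
    then have "modd_res n (modd_res n k * modd_res n l) = modd_res n ((s * t) * (k * l))"
      by (rule modd_res_cong[OF assms])
    also have "\<dots> = modd_res n (k * l)"
      using s(1) t(1) by (auto simp: modd_res_minus[OF assms])
    finally show ?thesis ..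
  qed
  then show ?thesis by (simp add: Modd_eq_def)
qed

end
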